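(* Let $n\geq 1$ be an integer and let $K$ be a field of characteristic $0$ or of characteristic $p$ with $p\nmid n$. Endow $M_n(K)$ with the Vasilovsky $\mathbb{Z}_n$-grading. For a multilinear polynomial $f=f(x_1,\dots,x_m)\in K\langle X\rangle$ (in any number $m\ge 1$ of variables) consider the properties: (S1) $f(a_1,\dots,a_m)=0$ for all homogeneous $a_1,\dots,a_m\in M_n(K)$ with $\sum_{i=1}^m\deg(a_i)\neq 0$ in $\mathbb{Z}_n$; (S2) $tr(f(a_1,\dots,a_m))=0$ for all homogeneous $a_1,\dots,a_m\in M_n(K)$ with $\sum_{i=1}^m\deg(a_i)= 0$ in $\mathbb{Z}_n$. Then the Lvov-Kaplansky conjecture for $M_n(K)$, i.e. the assertion that for every multilinear polynomial $f\in K\langle X\rangle$ the image $Im(f)$ of $f$ on $M_n(K)$ is $\{0\}$, the set of scalar matrices, $sl_n(K)$, or $M_n(K)$, is true if and only if the following two assertions hold for every multilinear polynomial $f\in K\langle X\rangle$: (1) if $f$ does not satisfy (S1) and satisfies (S2), then $Im(f)=sl_n(K)$; (2) if $f$ satisfies neither (S1) nor (S2), then $Im(f)=M_n(K)$.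
   Context: $K\langle X\rangle$ is the free associative $K$-algebra on a countable set $X$ of noncommuting variables. A polynomial $f(x_1,\dots,x_m)\in K\langle X\rangle$ is multilinear if $f=\sum_{\sigma\in S_m}\alpha_\sigma x_{\sigma(1)}\cdots x_{\sigma(m)}$ with $\alpha_\sigma\in K$. Its image on $M_n(K)$ is $Im(f)=\{f(b_1,\dots,b_m): b_1,\dots,b_m\in M_n(K)\}$. $sl_n(K)$ is the set of trace zero matrices in $M_n(K)$. The Vasilovsky grading is $M_n(K)=\bigoplus_{g\in\mathbb{Z}_n}A_g$, where $A_g$ is the span of the matrix units $E_{i,j}$ with $j-i\equiv g \pmod n$. A matrix $a$ is homogeneous of degree $g$, written $\deg(a)=g$, if $a\in A_g$. *)

theory Defs
  imports
    "HOL-Library.Poly_Mapping"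
    "HOL-Combinatorics.Permutations"
    "HOL-Number_Theory.Cong"
    "Jordan_Normal_Form.Matrix"
    "Jordan_Normal_Form.VS_Connect"
begin

section \<open>The free associative algebra\<close>

text \<open>
  The free monoid on the alphabet \<open>'x\<close>, written additively because that is how
  \<^theory>\<open>HOL-Library.Poly_Mapping\<close> indexes convolution: with it, \<open>'x word \<Rightarrow>\<^sub>0 'a\<close> is the
  monoid algebra of the free monoid, i.e. the free associative \<open>'a\<close>-algebra on \<open>'x\<close>, and its
  ring structure is the one from the library.
\<close>

datatype 'x word = Word (letters: "'x list")

instantiation word :: (type) monoid_add
begin

definition zero_word :: "'a word" where
  "0 = Word []"

definition plus_word :: "'a word \<Rightarrow> 'a word \<Rightarrow> 'a word" where
  "u + v = Word (letters u @ letters v)"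

instance
  by standard (simp_all add: zero_word_def plus_word_def)

end

text \<open>The countable set of variables is \<^typ>\<open>nat\<close>; the variables of a polynomial
  \<open>f(x\<^sub>1, \<dots>, x\<^sub>m)\<close> are those with index in \<open>{1..m}\<close>.\<close>

type_synonym 'a free_algebra = "nat word \<Rightarrow>\<^sub>0 'a"

definition Const :: "'a::field \<Rightarrow> 'a free_algebra" where
  "Const c = Poly_Mapping.single 0 c"

definition Var :: "nat \<Rightarrow> 'a::field free_algebra" where
  "Var i = Poly_Mapping.single (Word [i]) 1"

definition multilinear :: "nat \<Rightarrow> 'a::field free_algebra \<Rightarrow> bool" where
  "multilinear m f \<longleftrightarrow>
     (\<exists>\<alpha>. f = (\<Sum>\<sigma> | \<sigma> permutes {1..m}.
        Const (\<alpha> \<sigma>) * prod_list (map (\<lambda>i. Var (\<sigma> i)) [1..<Suc m])))"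


section \<open>Evaluation on matrices\<close>

definition eval_word :: "nat \<Rightarrow> (nat \<Rightarrow> 'a::field mat) \<Rightarrow> nat word \<Rightarrow> 'a mat" where
  "eval_word n b w = foldr (\<lambda>i A. b i * A) (letters w) (1\<^sub>m n)"

definition eval_mat :: "nat \<Rightarrow> (nat \<Rightarrow> 'a::field mat) \<Rightarrow> 'a free_algebra \<Rightarrow> 'a mat" where
  "eval_mat n b f =
     finsum (module_mat TYPE('a) n n)
       (\<lambda>w. Poly_Mapping.lookup f w \<cdot>\<^sub>m eval_word n b w) (Poly_Mapping.keys f)"

definition poly_image :: "nat \<Rightarrow> nat \<Rightarrow> 'a::field free_algebra \<Rightarrow> 'a mat set" where
  "poly_image n m f = {eval_mat n b f | b. \<forall>i\<in>{1..m}. b i \<in> carrier_mat n n}"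

definition scalar_matrices :: "nat \<Rightarrow> 'a::field mat set" where
  "scalar_matrices n = {c \<cdot>\<^sub>m 1\<^sub>m n | c. True}"

definition tr :: "'a::field mat \<Rightarrow> 'a" where
  "tr A = (\<Sum>i<dim_row A. A $$ (i, i))"

definition sl :: "nat \<Rightarrow> 'a::field mat set" where
  "sl n = {A \<in> carrier_mat n n. tr A = 0}"


section \<open>The Vasilovsky grading\<close>

text \<open>Row and column indices run over \<open>{0..<n}\<close> instead of \<open>{1..n}\<close>, which leaves the
  differences \<open>j - i\<close> unchanged. An element of \<open>\<int>\<^sub>n\<close> is given by any integer representing it.\<close>

definition matrix_unit :: "nat \<Rightarrow> nat \<Rightarrow> nat \<Rightarrow> 'a::field mat" where
  "matrix_unit n i j = mat n n (\<lambda>(k, l). if k = i \<and> l = j then 1 else 0)"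

definition vasilovsky :: "nat \<Rightarrow> int \<Rightarrow> 'a::field mat set" where
  "vasilovsky n g =
     LinearCombinations.module.span class_ring (module_mat TYPE('a) n n)
       {matrix_unit n i j | i j. i < n \<and> j < n \<and> [int j - int i = g] (mod int n)}"

text \<open>The zero matrix is homogeneous of every degree, so the degrees are quantified
  along with the matrices.\<close>

definition S1 :: "nat \<Rightarrow> nat \<Rightarrow> 'a::field free_algebra \<Rightarrow> bool" where
  "S1 n m f \<longleftrightarrow>
     (\<forall>a g. (\<forall>i\<in>{1..m}. a i \<in> vasilovsky n (g i)) \<and> \<not> [(\<Sum>i=1..m. g i) = 0] (mod int n)
        \<longrightarrow> eval_mat n a f = 0\<^sub>m n n)"

definition S2 :: "nat \<Rightarrow> nat \<Rightarrow> 'a::field free_algebra \<Rightarrow> bool" where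
  "S2 n m f \<longleftrightarrow>
     (\<forall>a g. (\<forall>i\<in>{1..m}. a i \<in> vasilovsky n (g i)) \<and> [(\<Sum>i=1..m. g i) = 0] (mod int n)
        \<longrightarrow> tr (eval_mat n a f) = 0)"


section \<open>The Lvov--Kaplansky conjecture\<close>

definition lvov_kaplansky :: "'a::field itself \<Rightarrow> nat \<Rightarrow> bool" where
  "lvov_kaplansky _ n \<longleftrightarrow>
     (\<forall>m\<ge>1. \<forall>f :: 'a free_algebra. multilinear m f \<longrightarrow>
        poly_image n m f = {0\<^sub>m n n} \<or> poly_image n m f = scalar_matrices n \<or>
        poly_image n m f = sl n \<or> poly_image n m f = carrier_mat n n)"

end

theory Submission
  imports Defs
begin

text \<open>
  The conditions \<open>S1\<close> and \<open>S2\<close> locate the image of a multilinear \<open>f\<close> among the four candidates,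
  because \<open>f\<close> is additive in every variable and every matrix is a sum of homogeneous ones: a
  linear condition on the values of \<open>f\<close> holds everywhere as soon as it holds on homogeneous
  arguments (\<open>multiadditive_vanishes\<close>). Moreover \<open>f\<close> maps homogeneous arguments of degrees
  \<open>g\<^sub>1, \<dots>, g\<^sub>m\<close> into the component of degree \<open>g\<^sub>1 + \<dots> + g\<^sub>m\<close> (\<open>eval_mat_homogeneous\<close>), and a
  component of nonzero degree consists of matrices with zero diagonal.

  \<^item> If \<open>S1\<close> holds, only total degree zero contributes, so all values of \<open>f\<close> are diagonal. The
    image is invariant under conjugation, and a diagonal matrix all of whose conjugates are
    diagonal is scalar. As the image is also closed under scalar multiplication, it is \<open>{0}\<close> or
    the set of all scalar matrices (\<open>S1_imp_image\<close>).

  \<^item> If \<open>S1\<close> fails, the image contains a nonzero matrix with zero diagonal, which is not scalar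
    (\<open>not_S1_imp_nonscalar\<close>). Of the four candidates only \<open>sl n\<close> and the full matrix algebra
    remain.

  \<^item> Components of nonzero degree have trace zero, so \<open>S2\<close> says exactly that the image lies in
    \<open>sl n\<close> (\<open>S2_iff_image_subset_sl\<close>). Since \<open>sl n\<close> is a proper subset of the matrix algebra,
    \<open>S2\<close> decides between the two remaining candidates.

  Hence the conjecture is true of every polynomial with \<open>S1\<close>, and for
  the others it asserts precisely the two conditions of the theorem.
\<close>

section \<open>Homogeneous components\<close>

lemma matrix_unit_carrier [simp]: "matrix_unit n i j \<in> carrier_mat n n"
  by (simp add: matrix_unit_def)

lemma matrix_unit_dim [simp]:
  "dim_row (matrix_unit n i j) = n" "dim_col (matrix_unit n i j) = n"
  by (simp_all add: matrix_unit_def)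

text \<open>
  Subtracting from a matrix its part at one position of the support leaves a matrix with smaller
  support, so induction on the set of allowed positions applies.
\<close>

lemma matrix_supported_in_span:
  fixes B :: "'a::field mat"
  assumes "finite S" "S \<subseteq> {..<n} \<times> {..<n}" "B \<in> carrier_mat n n"
    and "\<And>i j. i < n \<Longrightarrow> j < n \<Longrightarrow> (i, j) \<notin> S \<Longrightarrow> B $$ (i, j) = 0"
  shows "B \<in> LinearCombinations.module.span class_ring (module_mat TYPE('a) n n)
                {matrix_unit n i j | i j. (i, j) \<in> S}"
  using assms
proof (induction S arbitrary: B rule: finite_induct)
  interpret matrix_vs n n "TYPE('a)" .
  case empty
  have "B = 0\<^sub>m n n"
    using empty.prems by (intro eq_matI) auto
  then show ?case
    using span_zero by (simp add: module_mat_simps)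
next
  interpret matrix_vs n n "TYPE('a)" .
  case (insert p S)
  obtain i j where p: "p = (i, j)" and ij: "i < n" "j < n"
    using insert.prems(1) by (cases p) auto
  let ?U = "\<lambda>S. {matrix_unit n i j | i j. (i, j) \<in> S} :: 'a mat set"
  let ?E = "matrix_unit n i j :: 'a mat"
  define C where "C = B - B $$ (i, j) \<cdot>\<^sub>m ?E"
  have C: "C \<in> carrier_mat n n"
    unfolding C_def by (intro minus_carrier_mat smult_carrier_mat) simp
  have sub: "submodule class_ring (span (?U (insert p S))) V"
    by (rule span_is_submodule) (auto simp: module_mat_simps)
  have "C \<in> span (?U S)"
  proof (rule insert.IH)
    fix k l assume kl: "k < n" "l < n" "(k, l) \<notin> S"
    show "C $$ (k, l) = 0"
      using kl insert.prems p ij by (cases "(k, l) = p") (auto simp: C_def matrix_unit_def)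
  qed (use insert.prems C in auto)
  also have "\<dots> \<subseteq> span (?U (insert p S))"
    by (rule span_is_monotone) auto
  finally have C_span: "C \<in> span (?U (insert p S))" .
  have "?E \<in> span (?U (insert p S))"
    by (rule subsetD[OF in_own_span]) (auto simp: module_mat_simps p)
  then have "B $$ (i, j) \<cdot>\<^sub>m ?E \<in> span (?U (insert p S))"
    using LinearCombinations.submodule.smult_closed[OF sub] by (simp add: matrix_vs_simps)
  then have "C + B $$ (i, j) \<cdot>\<^sub>m ?E \<in> span (?U (insert p S))"
    using LinearCombinations.submodule.m_closed[OF sub C_span] by (simp add: module_mat_simps)
  moreover have "C + B $$ (i, j) \<cdot>\<^sub>m ?E = B"
    using insert.prems(2) by (intro eq_matI) (auto simp: C_def)
  ultimately show ?case by simp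
qed

text \<open>
  The span of the matrix units on the positions with \<open>j - i \<equiv> g\<close> is the set of matrices
  supported there. All later reasoning about degrees inspects single entries through this
  description.
\<close>

lemma vasilovsky_eq:
  "vasilovsky n g = {A :: 'a::field mat. A \<in> carrier_mat n n \<and>
     (\<forall>i<n. \<forall>j<n. A $$ (i, j) \<noteq> 0 \<longrightarrow> [int j - int i = g] (mod int n))}"
    (is "?L = ?R")
proof
  interpret matrix_vs n n "TYPE('a)" .
  let ?U = "{matrix_unit n i j | i j. i < n \<and> j < n \<and> [int j - int i = g] (mod int n)} :: 'a mat set"
  show "?L \<subseteq> ?R"
    unfolding vasilovsky_def
  proof (rule span_is_subset)
    show "?U \<subseteq> ?R"
      by (auto simp: matrix_unit_def split: if_splits)
    show "submodule class_ring ?R V"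
    proof (rule LinearCombinations.submodule.intro)
      fix A B :: "'a mat" assume "A \<in> ?R" "B \<in> ?R"
      then show "A \<oplus>\<^bsub>V\<^esub> B \<in> ?R"
        by (auto simp: module_mat_simps) (metis add.right_neutral)
    next
      fix a and B :: "'a mat" assume "B \<in> ?R"
      then show "a \<odot>\<^bsub>V\<^esub> B \<in> ?R"
        by (auto simp: module_mat_simps)
    qed (auto simp: module_mat_simps intro: module_axioms)
  qed
  show "?R \<subseteq> ?L"
  proof
    fix A assume A: "A \<in> ?R"
    let ?S = "{(i, j). i < n \<and> j < n \<and> [int j - int i = g] (mod int n)}"
    have "?S \<subseteq> {..<n} \<times> {..<n}" by auto
    moreover from this have "finite ?S" by (rule finite_subset) simp
    ultimately have "A \<in> span {matrix_unit n i j | i j. (i, j) \<in> ?S}"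
      using A by (intro matrix_supported_in_span) auto
    then show "A \<in> ?L"
      by (simp add: vasilovsky_def)
  qed
qed

lemma vasilovsky_carrier: "A \<in> vasilovsky n g \<Longrightarrow> A \<in> carrier_mat n n"
  by (simp add: vasilovsky_eq)

lemma vasilovskyD:
  "A \<in> vasilovsky n g \<Longrightarrow> i < n \<Longrightarrow> j < n \<Longrightarrow> A $$ (i, j) \<noteq> 0 \<Longrightarrow> [int j - int i = g] (mod int n)"
  by (simp add: vasilovsky_eq)

lemma one_in_vasilovsky: "1\<^sub>m n \<in> vasilovsky n 0"
  by (auto simp: vasilovsky_eq)

lemma times_mat_entry:
  assumes "A \<in> carrier_mat n n" "B \<in> carrier_mat n n" "i < n" "j < n"
  shows "(A * B) $$ (i, j) = (\<Sum>k<n. A $$ (i, k) * B $$ (k, j))"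
  using assms by (auto simp: scalar_prod_def atLeast0LessThan intro!: sum.cong)

text \<open>
  A nonzero entry of the product comes from a path \<open>i \<rightarrow> k \<rightarrow> j\<close> through nonzero entries of the
  factors, and the differences of the indices add up along the path.
\<close>

lemma vasilovsky_mult:
  assumes A: "A \<in> vasilovsky n g" and B: "B \<in> vasilovsky n h"
  shows "A * B \<in> vasilovsky n (g + h)"
proof -
  have car: "A \<in> carrier_mat n n" "B \<in> carrier_mat n n"
    using A B by (simp_all add: vasilovsky_carrier)
  have "[int j - int i = g + h] (mod int n)" if ij: "i < n" "j < n" "(A * B) $$ (i, j) \<noteq> 0" for i j
  proof -
    have "(\<Sum>k<n. A $$ (i, k) * B $$ (k, j)) \<noteq> 0"
      using times_mat_entry[OF car ij(1,2)] ij(3) by simp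
    then obtain k where k: "k < n" "A $$ (i, k) * B $$ (k, j) \<noteq> 0"
      by (rule sum.not_neutral_contains_not_neutral) auto
    have "[(int k - int i) + (int j - int k) = g + h] (mod int n)"
      using vasilovskyD[OF A] vasilovskyD[OF B] ij k by (intro cong_add) auto
    then show ?thesis by simp
  qed
  with car show ?thesis
    by (simp add: vasilovsky_eq)
qed

text \<open>
  The matrix is built up from its homogeneous components one degree at a time: \<open>trunc k\<close> below
  is the sum of the components of degrees \<open>0, \<dots>, k - 1\<close>. Only additivity is used, which makes the
  result applicable to a single entry, to the trace, and to one slot of a multilinear map.
\<close>

lemma additive_vanishes:
  fixes \<psi> :: "'a::field mat \<Rightarrow> 'b::ab_group_add"
  assumes add: "\<And>X Y. X \<in> carrier_mat n n \<Longrightarrow> Y \<in> carrier_mat n n \<Longrightarrow> \<psi> (X + Y) = \<psi> X + \<psi> Y"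
    and hom: "\<And>X g. X \<in> vasilovsky n g \<Longrightarrow> \<psi> X = 0"
    and M: "M \<in> carrier_mat n n"
  shows "\<psi> M = 0"
proof -
  define trunc where
    "trunc k = mat n n (\<lambda>(i, j). if (int j - int i) mod int n < int k then M $$ (i, j) else 0)" for k
  have "\<psi> (trunc k) = 0" for k
  proof (induction k)
    case 0
    have nonneg: "\<not> (int j - int i) mod int n < 0" if "i < n" for i j
      using that by (simp add: not_less)
    have "trunc 0 = 0\<^sub>m n n"
      by (intro eq_matI) (auto simp: trunc_def nonneg)
    moreover have "0\<^sub>m n n \<in> vasilovsky n 0"
      by (auto simp: vasilovsky_eq)
    ultimately show ?case
      using hom by metis
  next
    case (Suc k)
    define C where "C = mat n n (\<lambda>(i, j). if (int j - int i) mod int n = int k then M $$ (i, j) else 0)"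
    have "[int j - int i = int k] (mod int n)" if "(int j - int i) mod int n = int k" for i j
      using that by (metis cong_def mod_mod_trivial)
    then have C: "C \<in> vasilovsky n (int k)"
      by (auto simp: vasilovsky_eq C_def)
    have "trunc (Suc k) = trunc k + C"
      by (intro eq_matI) (auto simp: trunc_def C_def)
    moreover have "\<psi> (trunc k + C) = \<psi> (trunc k) + \<psi> C"
      by (rule add) (simp_all add: trunc_def C_def)
    ultimately show ?case
      using Suc.IH hom[OF C] by simp
  qed
  moreover have "trunc n = M"
    using M by (intro eq_matI) (auto simp: trunc_def)
  ultimately show ?thesis
    by metis
qed

text \<open>
  The slots are released from homogeneity one after the other: \<open>J\<close> below is the set of slots
  that already hold arbitrary matrices. This avoids expanding a value into the sum over all
  choices of components.
\<close>

lemma multiadditive_vanishes: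
  fixes \<phi> :: "('i \<Rightarrow> 'a::field mat) \<Rightarrow> 'b::ab_group_add"
  assumes "finite I"
    and add: "\<And>b i X Y. \<forall>k\<in>I. b k \<in> carrier_mat n n \<Longrightarrow> i \<in> I \<Longrightarrow>
      X \<in> carrier_mat n n \<Longrightarrow> Y \<in> carrier_mat n n \<Longrightarrow>
      \<phi> (b(i := X + Y)) = \<phi> (b(i := X)) + \<phi> (b(i := Y))"
    and hom: "\<And>b g. \<forall>k\<in>I. b k \<in> vasilovsky n (g k) \<Longrightarrow> \<phi> b = 0"
    and b: "\<forall>k\<in>I. b k \<in> carrier_mat n n"
  shows "\<phi> b = 0"
proof -
  \<comment> \<open>For \<open>J = {}\<close> this is the assumption on homogeneous tuples, for \<open>J = I\<close> it is the claim.\<close>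
  have "\<phi> b = 0"
    if "J \<subseteq> I" "\<forall>k\<in>I. b k \<in> carrier_mat n n" "\<forall>k\<in>I - J. \<exists>g. b k \<in> vasilovsky n g" for J b
    using finite_subset[OF that(1) \<open>finite I\<close>] that
  proof (induction J arbitrary: b rule: finite_induct)
    case empty
    then show ?case
      using hom by (metis Diff_empty)
  next
    case (insert i J)
    have "\<phi> (b(i := b i)) = 0"
    proof (rule additive_vanishes[where \<psi> = "\<lambda>X. \<phi> (b(i := X))"])
      fix X :: "'a mat" and g assume "X \<in> vasilovsky n g"
      then show "\<phi> (b(i := X)) = 0"
        using insert.prems by (intro insert.IH) (auto simp: vasilovsky_carrier)
    qed (use insert.prems add in auto)
    then show ?case by simp
  qed
  from this[of I b] b show ?thesis by simp
qed


section \<open>Evaluation of multilinear polynomials\<close>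

lemma eval_word_Nil [simp]: "eval_word n b (Word []) = 1\<^sub>m n"
  by (simp add: eval_word_def)

lemma eval_word_Cons [simp]: "eval_word n b (Word (i # xs)) = b i * eval_word n b (Word xs)"
  by (simp add: eval_word_def)

lemma eval_word_carrier:
  "\<forall>i\<in>set xs. b i \<in> carrier_mat n n \<Longrightarrow> eval_word n b (Word xs) \<in> carrier_mat n n"
  by (induction xs) auto

lemma eval_word_cong:
  "\<forall>i\<in>set xs. b i = c i \<Longrightarrow> eval_word n b (Word xs) = eval_word n c (Word xs)"
  by (induction xs) auto

lemma eval_word_append:
  assumes "\<forall>i\<in>set xs \<union> set ys. b i \<in> carrier_mat n n"
  shows "eval_word n b (Word (xs @ ys)) = eval_word n b (Word xs) * eval_word n b (Word ys)"
  using assms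
proof (induction xs)
  case Nil
  then show ?case
    using left_mult_one_mat[OF eval_word_carrier[of ys b n]] by simp
next
  case (Cons i xs)
  then show ?case
    by (simp add: eval_word_carrier assoc_mult_mat[of _ n n _ n _ n])
qed

text \<open>
  As a function of one of its letters, a word without repetitions is \<open>X \<mapsto> L * X * R\<close>; linearity
  in each variable follows from this form.
\<close>

lemma eval_word_slot:
  assumes "distinct xs" "i \<in> set xs" "\<forall>k\<in>set xs. b k \<in> carrier_mat n n"
  obtains L R where "L \<in> carrier_mat n n" "R \<in> carrier_mat n n"
    "\<And>X. X \<in> carrier_mat n n \<Longrightarrow> eval_word n (b(i := X)) (Word xs) = L * X * R"
proof -
  obtain us vs where xs: "xs = us @ i # vs"
    using assms(2) by (meson split_list)
  show thesis
  proof (rule that)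
    show "eval_word n b (Word us) \<in> carrier_mat n n" "eval_word n b (Word vs) \<in> carrier_mat n n"
      using assms(3) by (auto simp: xs intro!: eval_word_carrier)
    fix X :: "'a mat" assume X: "X \<in> carrier_mat n n"
    have "eval_word n (b(i := X)) (Word us) = eval_word n b (Word us)"
      "eval_word n (b(i := X)) (Word vs) = eval_word n b (Word vs)"
      using assms(1) by (auto simp: xs intro!: eval_word_cong)
    moreover have "eval_word n (b(i := X)) (Word xs) =
        eval_word n (b(i := X)) (Word us) * eval_word n (b(i := X)) (Word (i # vs))"
      unfolding xs using assms(3) X by (intro eval_word_append) (auto simp: xs)
    ultimately show "eval_word n (b(i := X)) (Word xs) = eval_word n b (Word us) * X * eval_word n b (Word vs)"
      using X \<open>eval_word n b (Word us) \<in> _\<close> \<open>eval_word n b (Word vs) \<in> _\<close> by simp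
  qed
qed

lemma eval_word_homogeneous:
  assumes "\<forall>i\<in>set xs. a i \<in> vasilovsky n (g i)"
  shows "eval_word n a (Word xs) \<in> vasilovsky n (sum_list (map g xs))"
  using assms by (induction xs) (auto simp: one_in_vasilovsky vasilovsky_mult)

text \<open>
  In the product of the matrices \<open>P * b i * Q\<close> the inner factors \<open>Q * P\<close> cancel. The factor
  \<open>P\<close> on the right of the conjugated word gives its last \<open>Q\<close> a partner as well.
\<close>

lemma eval_word_conjugate:
  assumes "P \<in> carrier_mat n n" "Q \<in> carrier_mat n n" "Q * P = 1\<^sub>m n"
    and "\<forall>i\<in>set xs. b i \<in> carrier_mat n n"
  shows "eval_word n (\<lambda>i. P * b i * Q) (Word xs) * P = P * eval_word n b (Word xs)"
  using assms(4)
proof (induction xs)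
  case Nil
  then show ?case using assms(1) by simp
next
  case (Cons i xs)
  let ?b = "\<lambda>i. P * b i * Q"
  have car: "b i \<in> carrier_mat n n" "eval_word n b (Word xs) \<in> carrier_mat n n"
    "eval_word n ?b (Word xs) \<in> carrier_mat n n"
    using Cons.prems assms(1,2) by (auto intro!: eval_word_carrier)
  have "?b i * eval_word n ?b (Word xs) * P = ?b i * (eval_word n ?b (Word xs) * P)"
    using car assms(1,2) by (intro assoc_mult_mat[of _ n n _ n _ n]) auto
  also have "eval_word n ?b (Word xs) * P = P * eval_word n b (Word xs)"
    using Cons by simp
  also have "?b i * (P * eval_word n b (Word xs)) = P * b i * (Q * P) * eval_word n b (Word xs)"
    using car assms(1,2) by (simp add: assoc_mult_mat[of _ n n _ n _ n])
  also have "\<dots> = P * (b i * eval_word n b (Word xs))"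
    using car assms by (simp add: assoc_mult_mat[of _ n n _ n _ n])
  finally show ?case by simp
qed

lemma prod_Var: "prod_list (map (\<lambda>i. Var (\<sigma> i)) xs) = Poly_Mapping.single (Word (map \<sigma> xs)) (1 :: 'a::field)"
proof (induction xs)
  case Nil
  then show ?case by (simp add: zero_word_def flip: single_one)
next
  case (Cons x xs)
  then show ?case by (simp add: Var_def mult_single plus_word_def)
qed

text \<open>
  This is the form in which multilinearity is used from here on: each of \<open>x\<^sub>1, \<dots>, x\<^sub>m\<close> occurs
  exactly once in every monomial.
\<close>

lemma multilinear_keys:
  fixes f :: "'a::field free_algebra"
  assumes "multilinear m f" "w \<in> Poly_Mapping.keys f"
  shows "distinct (letters w) \<and> set (letters w) = {1..m}"
proof -
  obtain \<alpha> where f: "f = (\<Sum>\<sigma> | \<sigma> permutes {1..m}.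
      Const (\<alpha> \<sigma>) * prod_list (map (\<lambda>i. Var (\<sigma> i)) [1..<Suc m]))"
    using assms(1) unfolding multilinear_def by blast
  have "Const (\<alpha> \<sigma>) * prod_list (map (\<lambda>i. Var (\<sigma> i)) [1..<Suc m]) =
      Poly_Mapping.single (Word (map \<sigma> [1..<Suc m])) (\<alpha> \<sigma>)" for \<sigma>
    unfolding prod_Var Const_def by (simp only: mult_single mult_1_right add_0_left)
  then have "f = (\<Sum>\<sigma> | \<sigma> permutes {1..m}. Poly_Mapping.single (Word (map \<sigma> [1..<Suc m])) (\<alpha> \<sigma>))"
    using f by simp
  then have "Poly_Mapping.keys f \<subseteq> (\<Union>\<sigma>\<in>{\<sigma>. \<sigma> permutes {1..m}}.
      Poly_Mapping.keys (Poly_Mapping.single (Word (map \<sigma> [1..<Suc m])) (\<alpha> \<sigma>)))"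
    using keys_sum by metis
  with assms(2) obtain \<sigma> where \<sigma>: "\<sigma> permutes {1..m}" and w: "w = Word (map \<sigma> [1..<Suc m])"
    by (auto split: if_splits)
  have "set [1..<Suc m] = {1..m}"
    by auto
  then show ?thesis
    using permutes_image[OF \<sigma>] permutes_inj_on[OF \<sigma>] unfolding w
    by (simp only: word.sel distinct_map set_map distinct_upt simp_thms)
qed

lemma
  fixes f :: "'a::field free_algebra"
  assumes "multilinear m f" "\<forall>i\<in>{1..m}. b i \<in> carrier_mat n n"
  shows eval_mat_carrier: "eval_mat n b f \<in> carrier_mat n n"
    and eval_mat_entry: "r < n \<Longrightarrow> s < n \<Longrightarrow> eval_mat n b f $$ (r, s) =
      (\<Sum>w\<in>Poly_Mapping.keys f. Poly_Mapping.lookup f w * eval_word n b w $$ (r, s))"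
proof -
  interpret matrix_vs n n "TYPE('a)" .
  have w: "eval_word n b w \<in> carrier_mat n n" if "w \<in> Poly_Mapping.keys f" for w
    using multilinear_keys[OF assms(1) that] assms(2) eval_word_carrier[of "letters w" b n] by simp
  have "finsum V (\<lambda>w. Poly_Mapping.lookup f w \<cdot>\<^sub>m eval_word n b w) W \<in> carrier_mat n n \<and>
      (\<forall>r<n. \<forall>s<n. finsum V (\<lambda>w. Poly_Mapping.lookup f w \<cdot>\<^sub>m eval_word n b w) W $$ (r, s) =
        (\<Sum>w\<in>W. Poly_Mapping.lookup f w * eval_word n b w $$ (r, s)))"
    if "W \<subseteq> Poly_Mapping.keys f" for W
    using finite_subset[OF that finite_keys] that
  proof (induction W rule: finite_induct)
    case empty
    then show ?case by (simp add: module_mat_simps)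
  next
    case (insert v W)
    have "finsum V (\<lambda>w. Poly_Mapping.lookup f w \<cdot>\<^sub>m eval_word n b w) (insert v W) =
        Poly_Mapping.lookup f v \<cdot>\<^sub>m eval_word n b v +
        finsum V (\<lambda>w. Poly_Mapping.lookup f w \<cdot>\<^sub>m eval_word n b w) W"
      using insert.hyps insert.prems w
      by (subst finsum_insert) (auto simp: module_mat_simps)
    then show ?case
      using insert w[of v] by auto
  qed
  from this[OF subset_refl] show "eval_mat n b f \<in> carrier_mat n n"
    "r < n \<Longrightarrow> s < n \<Longrightarrow> eval_mat n b f $$ (r, s) =
      (\<Sum>w\<in>Poly_Mapping.keys f. Poly_Mapping.lookup f w * eval_word n b w $$ (r, s))"
    by (auto simp: eval_mat_def)
qed

lemma multilinear_slot:
  fixes f :: "'a::field free_algebra"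
  assumes "multilinear m f" "\<forall>k\<in>{1..m}. b k \<in> carrier_mat n n" "i \<in> {1..m}" "w \<in> Poly_Mapping.keys f"
  obtains L R where "L \<in> carrier_mat n n" "R \<in> carrier_mat n n"
    "\<And>X. X \<in> carrier_mat n n \<Longrightarrow> eval_word n (b(i := X)) w = L * X * R"
  using eval_word_slot[of "letters w" i b n] multilinear_keys[OF assms(1,4)] assms(2,3)
  by auto

lemma eval_mat_add:
  fixes f :: "'a::field free_algebra"
  assumes f: "multilinear m f" and b: "\<forall>k\<in>{1..m}. b k \<in> carrier_mat n n" and i: "i \<in> {1..m}"
    and X: "X \<in> carrier_mat n n" and Y: "Y \<in> carrier_mat n n"
  shows "eval_mat n (b(i := X + Y)) f = eval_mat n (b(i := X)) f + eval_mat n (b(i := Y)) f"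
proof -
  have upd: "\<forall>k\<in>{1..m}. (b(i := Z)) k \<in> carrier_mat n n" if "Z \<in> carrier_mat n n" for Z
    using b that by simp
  have car: "eval_mat n (b(i := Z)) f \<in> carrier_mat n n" if "Z \<in> carrier_mat n n" for Z
    by (rule eval_mat_carrier[OF f upd[OF that]])
  have entry: "eval_mat n (b(i := Z)) f $$ (r, s) =
      (\<Sum>w\<in>Poly_Mapping.keys f. Poly_Mapping.lookup f w * eval_word n (b(i := Z)) w $$ (r, s))"
    if "Z \<in> carrier_mat n n" "r < n" "s < n" for Z r s
    by (rule eval_mat_entry[OF f upd[OF that(1)] that(2,3)])
  have word: "eval_word n (b(i := X + Y)) w $$ (r, s) =
      eval_word n (b(i := X)) w $$ (r, s) + eval_word n (b(i := Y)) w $$ (r, s)"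
    if w: "w \<in> Poly_Mapping.keys f" and rs: "r < n" "s < n" for w r s
  proof -
    obtain L R where LR: "L \<in> carrier_mat n n" "R \<in> carrier_mat n n"
      and eq: "\<And>X. X \<in> carrier_mat n n \<Longrightarrow> eval_word n (b(i := X)) w = L * X * R"
      using multilinear_slot[OF f b i w] by blast
    have "L * (X + Y) * R = L * X * R + L * Y * R"
      using LR X Y by (simp add: mult_add_distrib_mat[of _ n n _ n] add_mult_distrib_mat[of _ n n _ _ n])
    then have "eval_word n (b(i := X + Y)) w = L * X * R + L * Y * R"
      using eq[of "X + Y"] X Y by simp
    then show ?thesis
      using eq[OF X] eq[OF Y] LR X Y rs by simp
  qed
  show ?thesis
  proof (rule eq_matI)
    fix r s
    assume "r < dim_row (eval_mat n (b(i := X)) f + eval_mat n (b(i := Y)) f)"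
      and "s < dim_col (eval_mat n (b(i := X)) f + eval_mat n (b(i := Y)) f)"
    then have rs: "r < n" "s < n"
      using car[OF Y] by auto
    then show "eval_mat n (b(i := X + Y)) f $$ (r, s) =
        (eval_mat n (b(i := X)) f + eval_mat n (b(i := Y)) f) $$ (r, s)"
      using X Y car[OF X] car[OF Y]
      by (simp add: entry word sum.distrib distrib_left)
  qed (use car[of "X + Y"] car[OF X] car[OF Y] X Y in auto)
qed

lemma eval_mat_smult:
  fixes f :: "'a::field free_algebra"
  assumes f: "multilinear m f" and b: "\<forall>k\<in>{1..m}. b k \<in> carrier_mat n n" and i: "i \<in> {1..m}"
  shows "eval_mat n (b(i := c \<cdot>\<^sub>m b i)) f = c \<cdot>\<^sub>m eval_mat n b f"
proof -
  have upd: "\<forall>k\<in>{1..m}. (b(i := c \<cdot>\<^sub>m b i)) k \<in> carrier_mat n n"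
    using b i by simp
  have car: "eval_mat n (b(i := c \<cdot>\<^sub>m b i)) f \<in> carrier_mat n n" "eval_mat n b f \<in> carrier_mat n n"
    by (rule eval_mat_carrier[OF f upd] eval_mat_carrier[OF f b])+
  have entry: "eval_mat n (b(i := c \<cdot>\<^sub>m b i)) f $$ (r, s) = (\<Sum>w\<in>Poly_Mapping.keys f.
      Poly_Mapping.lookup f w * eval_word n (b(i := c \<cdot>\<^sub>m b i)) w $$ (r, s))"
    if "r < n" "s < n" for r s
    by (rule eval_mat_entry[OF f upd that])
  have word: "eval_word n (b(i := c \<cdot>\<^sub>m b i)) w $$ (r, s) = c * eval_word n b w $$ (r, s)"
    if w: "w \<in> Poly_Mapping.keys f" and rs: "r < n" "s < n" for w r s
  proof -
    obtain L R where LR: "L \<in> carrier_mat n n" "R \<in> carrier_mat n n"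
      and eq: "\<And>X. X \<in> carrier_mat n n \<Longrightarrow> eval_word n (b(i := X)) w = L * X * R"
      using multilinear_slot[OF f b i w] by blast
    have bi: "b i \<in> carrier_mat n n"
      using b i by simp
    have "L * (c \<cdot>\<^sub>m b i) * R = c \<cdot>\<^sub>m (L * b i * R)"
      using LR bi by (simp add: mult_smult_distrib[of _ n n _ n] mult_smult_assoc_mat[of _ n n _ n])
    then have "eval_word n (b(i := c \<cdot>\<^sub>m b i)) w = c \<cdot>\<^sub>m (L * b i * R)"
      using eq[of "c \<cdot>\<^sub>m b i"] bi by simp
    then show ?thesis
      using eq[OF bi] LR bi rs by simp
  qed
  show ?thesis
  proof (rule eq_matI)
    fix r s
    assume "r < dim_row (c \<cdot>\<^sub>m eval_mat n b f)" and "s < dim_col (c \<cdot>\<^sub>m eval_mat n b f)"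
    then have rs: "r < n" "s < n"
      using car by auto
    then show "eval_mat n (b(i := c \<cdot>\<^sub>m b i)) f $$ (r, s) = (c \<cdot>\<^sub>m eval_mat n b f) $$ (r, s)"
      using car by (simp add: entry eval_mat_entry[OF f b] word sum_distrib_left mult.left_commute)
  qed (use car in auto)
qed

text \<open>
  Every monomial contains each variable once, so all monomials have the same degree
  \<open>g 1 + \<dots> + g m\<close> on such arguments.
\<close>

lemma eval_mat_homogeneous:
  fixes f :: "'a::field free_algebra"
  assumes f: "multilinear m f" and a: "\<forall>i\<in>{1..m}. a i \<in> vasilovsky n (g i)"
  shows "eval_mat n a f \<in> vasilovsky n (\<Sum>i=1..m. g i)"
proof -
  have car: "\<forall>i\<in>{1..m}. a i \<in> carrier_mat n n"
    using a by (auto simp: vasilovsky_carrier)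
  have word: "eval_word n a w \<in> vasilovsky n (\<Sum>i=1..m. g i)" if "w \<in> Poly_Mapping.keys f" for w
    using eval_word_homogeneous[of "letters w" a n g] a multilinear_keys[OF f that]
    by (metis sum_list_distinct_conv_sum_set word.collapse)
  \<comment> \<open>A nonzero entry of the value is a nonzero entry of some monomial.\<close>
  have "[int s - int r = (\<Sum>i=1..m. g i)] (mod int n)"
    if rs: "r < n" "s < n" and nz: "eval_mat n a f $$ (r, s) \<noteq> 0" for r s
  proof -
    have "(\<Sum>w\<in>Poly_Mapping.keys f. Poly_Mapping.lookup f w * eval_word n a w $$ (r, s)) \<noteq> 0"
      using nz eval_mat_entry[OF f car rs] by simp
    then obtain w where "w \<in> Poly_Mapping.keys f" "eval_word n a w $$ (r, s) \<noteq> 0"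
      by (rule sum.not_neutral_contains_not_neutral) auto
    then show ?thesis
      using vasilovskyD[OF word _ _] rs by blast
  qed
  then show ?thesis
    using eval_mat_carrier[OF f car] by (simp add: vasilovsky_eq)
qed

lemma eval_mat_conjugate:
  fixes f :: "'a::field free_algebra"
  assumes f: "multilinear m f" and b: "\<forall>k\<in>{1..m}. b k \<in> carrier_mat n n"
    and P: "P \<in> carrier_mat n n" and Q: "Q \<in> carrier_mat n n" and QP: "Q * P = 1\<^sub>m n"
  shows "eval_mat n (\<lambda>i. P * b i * Q) f * P = P * eval_mat n b f"
proof -
  let ?b = "\<lambda>i. P * b i * Q"
  have b': "\<forall>k\<in>{1..m}. ?b k \<in> carrier_mat n n"
    using b P Q by auto
  note car = eval_mat_carrier[OF f b'] eval_mat_carrier[OF f b]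
  note entry = eval_mat_entry[OF f b'] eval_mat_entry[OF f b]
  have word: "(\<Sum>k<n. eval_word n ?b w $$ (r, k) * P $$ (k, s)) = (\<Sum>k<n. P $$ (r, k) * eval_word n b w $$ (k, s))"
    if w: "w \<in> Poly_Mapping.keys f" and rs: "r < n" "s < n" for w r s
  proof -
    have lw: "set (letters w) = {1..m}"
      using multilinear_keys[OF f w] by simp
    have carw: "eval_word n b w \<in> carrier_mat n n" "eval_word n ?b w \<in> carrier_mat n n"
      using eval_word_carrier[of "letters w" b n] eval_word_carrier[of "letters w" ?b n] lw b b' by simp_all
    have "eval_word n ?b w * P = P * eval_word n b w"
      using eval_word_conjugate[OF P Q QP, of "letters w" b] lw b by simp
    then show ?thesis
      using times_mat_entry[OF carw(2) P rs] times_mat_entry[OF P carw(1) rs] by simp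
  qed
  show ?thesis
  proof (rule eq_matI)
    fix r s
    assume "r < dim_row (P * eval_mat n b f)" and "s < dim_col (P * eval_mat n b f)"
    then have rs: "r < n" "s < n"
      using car P by auto
    have "(eval_mat n ?b f * P) $$ (r, s) = (\<Sum>k<n. eval_mat n ?b f $$ (r, k) * P $$ (k, s))"
      using car P rs by (intro times_mat_entry)
    also have "\<dots> = (\<Sum>k<n. \<Sum>w\<in>Poly_Mapping.keys f.
        Poly_Mapping.lookup f w * (eval_word n ?b w $$ (r, k) * P $$ (k, s)))"
      using rs by (simp add: entry sum_distrib_right mult.assoc)
    also have "\<dots> = (\<Sum>w\<in>Poly_Mapping.keys f.
        Poly_Mapping.lookup f w * (\<Sum>k<n. eval_word n ?b w $$ (r, k) * P $$ (k, s)))"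
      by (subst sum.swap) (simp add: sum_distrib_left)
    also have "\<dots> = (\<Sum>w\<in>Poly_Mapping.keys f.
        Poly_Mapping.lookup f w * (\<Sum>k<n. P $$ (r, k) * eval_word n b w $$ (k, s)))"
      using rs by (simp add: word)
    also have "\<dots> = (\<Sum>k<n. \<Sum>w\<in>Poly_Mapping.keys f.
        P $$ (r, k) * (Poly_Mapping.lookup f w * eval_word n b w $$ (k, s)))"
      by (subst sum.swap) (simp add: sum_distrib_left mult.left_commute)
    also have "\<dots> = (\<Sum>k<n. P $$ (r, k) * eval_mat n b f $$ (k, s))"
      using rs by (simp add: entry sum_distrib_left)
    also have "\<dots> = (P * eval_mat n b f) $$ (r, s)"
      using car P rs by (intro times_mat_entry[symmetric])
    finally show "(eval_mat n ?b f * P) $$ (r, s) = (P * eval_mat n b f) $$ (r, s)" .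
  qed (use car P in auto)
qed


section \<open>Images of multilinear polynomials\<close>

lemma zero_in_poly_image:
  fixes f :: "'a::field free_algebra"
  assumes f: "multilinear m f" and "m \<ge> 1"
  shows "0\<^sub>m n n \<in> poly_image n m f"
proof -
  let ?b = "(\<lambda>i. 0\<^sub>m n n)(1 := 0 \<cdot>\<^sub>m 0\<^sub>m n n) :: nat \<Rightarrow> 'a mat"
  have "eval_mat n ?b f = 0 \<cdot>\<^sub>m eval_mat n (\<lambda>i. 0\<^sub>m n n) f"
    using eval_mat_smult[OF f, of "\<lambda>i. 0\<^sub>m n n" n 1 0] \<open>m \<ge> 1\<close> by simp
  also have "\<dots> = 0\<^sub>m n n"
    using eval_mat_carrier[OF f, of "\<lambda>i. 0\<^sub>m n n" n] by auto
  finally have "0\<^sub>m n n = eval_mat n ?b f" ..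
  then show ?thesis
    unfolding poly_image_def by auto
qed

lemma poly_image_carrier:
  fixes f :: "'a::field free_algebra"
  shows "multilinear m f \<Longrightarrow> poly_image n m f \<subseteq> carrier_mat n n"
  by (auto simp: poly_image_def simp del: One_nat_def intro: eval_mat_carrier)

text \<open>
  By additivity it suffices to treat homogeneous arguments. In total degree zero the value is
  diagonal by the grading, and in every other total degree it is zero by \<open>S1\<close>.
\<close>

lemma S1_imp_offdiagonal_zero:
  fixes f :: "'a::field free_algebra"
  assumes f: "multilinear m f" and S1: "S1 n m f"
    and b: "\<forall>k\<in>{1..m}. b k \<in> carrier_mat n n" and rs: "r < n" "s < n" "r \<noteq> s"
  shows "eval_mat n b f $$ (r, s) = 0"
proof (rule multiadditive_vanishes[where \<phi> = "\<lambda>b. eval_mat n b f $$ (r, s)" and I = "{1..m}"])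
  fix b :: "nat \<Rightarrow> 'a mat" and i and X Y :: "'a mat"
  assume b: "\<forall>k\<in>{1..m}. b k \<in> carrier_mat n n" and i: "i \<in> {1..m}"
    and XY: "X \<in> carrier_mat n n" "Y \<in> carrier_mat n n"
  have "eval_mat n (b(i := Y)) f \<in> carrier_mat n n"
    using b XY by (intro eval_mat_carrier[OF f]) simp
  then show "eval_mat n (b(i := X + Y)) f $$ (r, s) =
      eval_mat n (b(i := X)) f $$ (r, s) + eval_mat n (b(i := Y)) f $$ (r, s)"
    using eval_mat_add[OF f b i XY] rs by simp
next
  fix a :: "nat \<Rightarrow> 'a mat" and g
  assume a: "\<forall>k\<in>{1..m}. a k \<in> vasilovsky n (g k)"
  show "eval_mat n a f $$ (r, s) = 0"
  proof (cases "[(\<Sum>i=1..m. g i) = 0] (mod int n)")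
    case True
    show ?thesis
    proof (rule ccontr)
      assume "eval_mat n a f $$ (r, s) \<noteq> 0"
      then have "[int s - int r = 0] (mod int n)"
        using vasilovskyD[OF eval_mat_homogeneous[OF f a]] rs True cong_trans by blast
      then have "[int s = int r] (mod int n)"
        by (simp add: cong_diff_iff_cong_0)
      with rs show False
        by (simp add: cong_def)
    qed
  next
    case False
    then have "eval_mat n a f = 0\<^sub>m n n"
      using S1 a unfolding S1_def by blast
    then show ?thesis
      using rs by simp
  qed
qed (use b in auto)

lemma vasilovsky_diag_zero:
  assumes "A \<in> vasilovsky n g" "\<not> [g = 0] (mod int n)" "i < n"
  shows "A $$ (i, i) = 0"
  using vasilovskyD[OF assms(1,3,3)] assms(2) by (auto simp: cong_sym_eq)

text \<open>
  Again homogeneous arguments suffice. In total degree zero this is \<open>S2\<close>, and in every other total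
  degree the value has zero diagonal by the grading.
\<close>

lemma S2_imp_trace_zero:
  fixes f :: "'a::field free_algebra"
  assumes f: "multilinear m f" and S2: "S2 n m f"
    and b: "\<forall>k\<in>{1..m}. b k \<in> carrier_mat n n"
  shows "tr (eval_mat n b f) = 0"
proof (rule multiadditive_vanishes[where \<phi> = "\<lambda>b. tr (eval_mat n b f)" and I = "{1..m}"])
  fix b :: "nat \<Rightarrow> 'a mat" and i and X Y :: "'a mat"
  assume b: "\<forall>k\<in>{1..m}. b k \<in> carrier_mat n n" and i: "i \<in> {1..m}"
    and XY: "X \<in> carrier_mat n n" "Y \<in> carrier_mat n n"
  have "eval_mat n (b(i := X)) f \<in> carrier_mat n n" "eval_mat n (b(i := Y)) f \<in> carrier_mat n n"
    using b XY by (auto intro!: eval_mat_carrier[OF f])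
  then show "tr (eval_mat n (b(i := X + Y)) f) =
      tr (eval_mat n (b(i := X)) f) + tr (eval_mat n (b(i := Y)) f)"
    using eval_mat_add[OF f b i XY] by (simp add: tr_def sum.distrib)
next
  fix a :: "nat \<Rightarrow> 'a mat" and g
  assume a: "\<forall>k\<in>{1..m}. a k \<in> vasilovsky n (g k)"
  show "tr (eval_mat n a f) = 0"
  proof (cases "[(\<Sum>i=1..m. g i) = 0] (mod int n)")
    case True
    then show ?thesis
      using S2 a unfolding S2_def by blast
  next
    case False
    note hom = eval_mat_homogeneous[OF f a]
    then show ?thesis
      using vasilovsky_diag_zero[OF hom False] vasilovsky_carrier[OF hom] by (simp add: tr_def)
  qed
qed (use b in auto)

lemma matrix_unit_times:
  assumes "A \<in> carrier_mat n n" "i < n" "j < n" "r < n" "s < n"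
  shows "(matrix_unit n i j * A) $$ (r, s) = (if r = i then A $$ (j, s) else 0)"
    and "(A * matrix_unit n i j) $$ (r, s) = (if s = j then A $$ (r, i) else 0)"
proof -
  have "(\<Sum>k<n. matrix_unit n i j $$ (r, k) * A $$ (k, s)) =
      (\<Sum>k<n. if k = j then (if r = i then A $$ (j, s) else 0) else 0)"
    using assms by (intro sum.cong) (auto simp: matrix_unit_def)
  then show "(matrix_unit n i j * A) $$ (r, s) = (if r = i then A $$ (j, s) else 0)"
    using assms by (subst times_mat_entry) auto
  have "(\<Sum>k<n. A $$ (r, k) * matrix_unit n i j $$ (k, s)) =
      (\<Sum>k<n. if k = i then (if s = j then A $$ (r, i) else 0) else 0)"
    using assms by (intro sum.cong) (auto simp: matrix_unit_def)
  then show "(A * matrix_unit n i j) $$ (r, s) = (if s = j then A $$ (r, i) else 0)"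
    using assms by (subst times_mat_entry) auto
qed

text \<open>
  Let \<open>P = 1 + E\<close> with the matrix unit \<open>E\<close> at position \<open>(i, j)\<close>. Both the value \<open>D\<close> of \<open>f\<close> and its
  conjugate \<open>D'\<close> by \<open>P\<close> are values of \<open>f\<close>, hence diagonal. Comparing the entries \<open>(i, i)\<close> and
  \<open>(i, j)\<close> of \<open>D' * P = P * D\<close> expresses \<open>D' $$ (i, i)\<close> as \<open>D $$ (i, i)\<close> and as \<open>D $$ (j, j)\<close>.
\<close>

lemma S1_imp_diagonal_constant:
  fixes f :: "'a::field free_algebra"
  assumes f: "multilinear m f" and S1: "S1 n m f"
    and b: "\<forall>k\<in>{1..m}. b k \<in> carrier_mat n n" and ij: "i < n" "j < n" "i \<noteq> j"
  shows "eval_mat n b f $$ (i, i) = eval_mat n b f $$ (j, j)"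
proof -
  let ?E = "matrix_unit n i j :: 'a mat"
  define P where "P = 1\<^sub>m n + ?E"
  define Q where "Q = 1\<^sub>m n - ?E"
  define D where "D = eval_mat n b f"
  define D' where "D' = eval_mat n (\<lambda>i. P * b i * Q) f"
  have PQ: "P \<in> carrier_mat n n" "Q \<in> carrier_mat n n"
    by (simp_all add: P_def Q_def minus_carrier_mat)
  have EE: "?E * ?E = 0\<^sub>m n n"
  proof (rule eq_matI)
    fix r s assume "r < dim_row (0\<^sub>m n n :: 'a mat)" "s < dim_col (0\<^sub>m n n :: 'a mat)"
    then have rs: "r < n" "s < n" by auto
    have "?E $$ (j, s) = 0"
      using ij rs by (simp add: matrix_unit_def)
    then show "(?E * ?E) $$ (r, s) = 0\<^sub>m n n $$ (r, s)"
      using matrix_unit_times(1)[OF matrix_unit_carrier ij(1,2) rs, of i j] rs by (cases "r = i") simp_all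
  qed auto
  have "Q * P = Q * 1\<^sub>m n + Q * ?E"
    unfolding P_def by (rule mult_add_distrib_mat) (use PQ in auto)
  also have "Q * ?E = 1\<^sub>m n * ?E - ?E * ?E"
    unfolding Q_def by (rule minus_mult_distrib_mat) auto
  also have "Q * 1\<^sub>m n + (1\<^sub>m n * ?E - ?E * ?E) = 1\<^sub>m n"
    using PQ unfolding EE by (intro eq_matI) (auto simp: Q_def)
  finally have QP: "Q * P = 1\<^sub>m n" .
  have b': "\<forall>k\<in>{1..m}. P * b k * Q \<in> carrier_mat n n"
    using b PQ by auto
  have car: "D \<in> carrier_mat n n" "D' \<in> carrier_mat n n"
    unfolding D_def D'_def by (intro eval_mat_carrier[OF f] b b')+
  have off: "D $$ (r, s) = 0" "D' $$ (r, s) = 0" if "r < n" "s < n" "r \<noteq> s" for r s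
    using S1_imp_offdiagonal_zero[OF f S1 b that] S1_imp_offdiagonal_zero[OF f S1 b' that]
    by (simp_all add: D_def D'_def)
  have "D' * P = P * D"
    unfolding D_def D'_def by (rule eval_mat_conjugate[OF f b PQ QP])
  moreover have "D' * P = D' + D' * ?E"
    unfolding P_def using car by (subst mult_add_distrib_mat[of _ n n _ n]) auto
  moreover have "P * D = D + ?E * D"
    unfolding P_def using car by (subst add_mult_distrib_mat[of _ n n _ _ n]) auto
  ultimately have eq: "(D' + D' * ?E) $$ (r, s) = (D + ?E * D) $$ (r, s)" for r s
    by metis
  have entries: "D' $$ (r, s) + (if s = j then D' $$ (r, i) else 0) =
      D $$ (r, s) + (if r = i then D $$ (j, s) else 0)" if "r < n" "s < n" for r s
    using eq[of r s] that car ij by (simp add: matrix_unit_times del: index_mult_mat(1))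
  have "D' $$ (i, i) = D $$ (i, i)" "D' $$ (i, i) = D $$ (j, j)"
    using entries[of i i] entries[of i j] ij off[of i j] off[of j i] by auto
  then show ?thesis
    by (simp add: D_def)
qed

lemma zero_in_scalar_matrices: "0\<^sub>m n n \<in> (scalar_matrices n :: 'a::field mat set)"
proof -
  have "0\<^sub>m n n = (0 :: 'a) \<cdot>\<^sub>m 1\<^sub>m n"
    by (intro eq_matI) auto
  then show ?thesis
    unfolding scalar_matrices_def by blast
qed

lemma S1_imp_scalar_image:
  fixes f :: "'a::field free_algebra"
  assumes f: "multilinear m f" and S1: "S1 n m f"
  shows "poly_image n m f \<subseteq> scalar_matrices n"
proof
  fix A assume "A \<in> poly_image n m f"
  then obtain b where b: "\<forall>k\<in>{1..m}. b k \<in> carrier_mat n n" and A: "A = eval_mat n b f"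
    by (auto simp: poly_image_def)
  \<comment> \<open>The entry \<open>(0, 0)\<close> lies outside the matrix if \<open>n = 0\<close>, but then no entries are compared.\<close>
  have "A = A $$ (0, 0) \<cdot>\<^sub>m 1\<^sub>m n"
  proof (rule eq_matI)
    fix r s assume "r < dim_row (A $$ (0, 0) \<cdot>\<^sub>m 1\<^sub>m n)" "s < dim_col (A $$ (0, 0) \<cdot>\<^sub>m 1\<^sub>m n)"
    then have rs: "r < n" "s < n" by auto
    then have "A $$ (r, r) = A $$ (0, 0)"
      using S1_imp_diagonal_constant[OF f S1 b, of r 0] by (cases "r = 0") (auto simp: A)
    then show "A $$ (r, s) = (A $$ (0, 0) \<cdot>\<^sub>m 1\<^sub>m n) $$ (r, s)"
      using S1_imp_offdiagonal_zero[OF f S1 b rs] rs by (cases "r = s") (auto simp: A)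
  qed (use eval_mat_carrier[OF f b] in \<open>auto simp: A\<close>)
  then show "A \<in> scalar_matrices n"
    unfolding scalar_matrices_def by blast
qed

lemma poly_image_smult:
  fixes f :: "'a::field free_algebra"
  assumes f: "multilinear m f" and "m \<ge> 1" and "A \<in> poly_image n m f"
  shows "c \<cdot>\<^sub>m A \<in> poly_image n m f"
proof -
  obtain b where b: "\<forall>k\<in>{1..m}. b k \<in> carrier_mat n n" and A: "A = eval_mat n b f"
    using assms(3) by (auto simp: poly_image_def)
  have "c \<cdot>\<^sub>m A = eval_mat n (b(1 := c \<cdot>\<^sub>m b 1)) f"
    using eval_mat_smult[OF f b, of 1 c] \<open>m \<ge> 1\<close> by (simp add: A)
  moreover have "\<forall>k\<in>{1..m}. (b(1 := c \<cdot>\<^sub>m b 1)) k \<in> carrier_mat n n"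
    using b by auto
  ultimately show ?thesis
    unfolding poly_image_def by blast
qed

text \<open>
  A set of scalar matrices that is closed under multiplication by scalars and contains a nonzero
  matrix contains all scalar matrices.
\<close>

lemma S1_imp_image:
  fixes f :: "'a::field free_algebra"
  assumes f: "multilinear m f" and m: "m \<ge> 1" and S1: "S1 n m f"
  shows "poly_image n m f = {0\<^sub>m n n} \<or> poly_image n m f = scalar_matrices n"
proof (rule disjCI)
  note sub = S1_imp_scalar_image[OF f S1]
  assume "poly_image n m f \<noteq> scalar_matrices n"
  have "A = 0\<^sub>m n n" if A: "A \<in> poly_image n m f" for A
  proof (rule ccontr)
    assume nz: "A \<noteq> 0\<^sub>m n n"
    obtain c where c: "A = c \<cdot>\<^sub>m 1\<^sub>m n"
      using sub A by (auto simp: scalar_matrices_def)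
    have "c \<noteq> 0"
      using nz c by auto
    have "d \<cdot>\<^sub>m 1\<^sub>m n \<in> poly_image n m f" for d
    proof -
      have "d \<cdot>\<^sub>m 1\<^sub>m n = (d / c) \<cdot>\<^sub>m A"
        using \<open>c \<noteq> 0\<close> by (intro eq_matI) (auto simp: c)
      then show ?thesis
        using poly_image_smult[OF f m A] by simp
    qed
    then have "scalar_matrices n \<subseteq> poly_image n m f"
      by (auto simp: scalar_matrices_def)
    with sub \<open>poly_image n m f \<noteq> scalar_matrices n\<close> show False by blast
  qed
  then show "poly_image n m f = {0\<^sub>m n n}"
    using zero_in_poly_image[OF f m, of n] by blast
qed

text \<open>
  A failure of \<open>S1\<close> produces a nonzero value of nonzero degree. Its diagonal is zero, so it cannot
  be a scalar matrix.
\<close>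

lemma not_S1_imp_nonscalar:
  fixes f :: "'a::field free_algebra"
  assumes f: "multilinear m f" and "\<not> S1 n m f"
  shows "\<not> poly_image n m f \<subseteq> scalar_matrices n"
proof -
  obtain a g where a: "\<forall>i\<in>{1..m}. a i \<in> vasilovsky n (g i)"
    and g: "\<not> [(\<Sum>i=1..m. g i) = 0] (mod int n)" and nz: "eval_mat n a f \<noteq> 0\<^sub>m n n"
    using assms(2) unfolding S1_def by blast
  have hom: "eval_mat n a f \<in> vasilovsky n (\<Sum>i=1..m. g i)"
    by (rule eval_mat_homogeneous[OF f a])
  have "eval_mat n a f \<notin> scalar_matrices n"
  proof
    assume "eval_mat n a f \<in> scalar_matrices n"
    then obtain c where c: "eval_mat n a f = c \<cdot>\<^sub>m 1\<^sub>m n"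
      by (auto simp: scalar_matrices_def)
    then have "c = 0" if "i < n" for i
      using vasilovsky_diag_zero[OF hom g that] that by simp
    with c nz show False
      by (metis eq_matI index_one_mat(2,3) index_smult_mat index_zero_mat mult_zero_left)
  qed
  moreover have "eval_mat n a f \<in> poly_image n m f"
    using a vasilovsky_carrier unfolding poly_image_def by blast
  ultimately show ?thesis by blast
qed

lemma S2_iff_image_subset_sl:
  fixes f :: "'a::field free_algebra"
  assumes f: "multilinear m f"
  shows "S2 n m f \<longleftrightarrow> poly_image n m f \<subseteq> sl n"
proof
  assume "S2 n m f"
  then show "poly_image n m f \<subseteq> sl n"
    using poly_image_carrier[OF f, of n] S2_imp_trace_zero[OF f] by (auto simp: sl_def poly_image_def)
next
  assume "poly_image n m f \<subseteq> sl n"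
  then have "tr (eval_mat n a f) = 0" if "\<forall>i\<in>{1..m}. a i \<in> carrier_mat n n" for a
    using that by (auto simp: sl_def poly_image_def)
  then show "S2 n m f"
    unfolding S2_def by (meson vasilovsky_carrier)
qed

lemma carrier_mat_not_subset_sl:
  assumes "n \<ge> 1"
  shows "\<not> (carrier_mat n n :: 'a::field mat set) \<subseteq> sl n"
proof -
  have "tr (matrix_unit n 0 0 :: 'a mat) = (\<Sum>i<n. if i = 0 then 1 else 0)"
    unfolding tr_def by (intro sum.cong) (auto simp: matrix_unit_def)
  also have "\<dots> = 1"
    using assms by simp
  finally have "matrix_unit n 0 0 \<notin> (sl n :: 'a mat set)"
    by (simp add: sl_def)
  then show ?thesis
    using matrix_unit_carrier by blast
qed

theorem theorem4p7:
  fixes n :: nat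
  assumes "n \<ge> 1"
    and "CHAR('a::field) = 0 \<or> \<not> CHAR('a) dvd n"
  shows "lvov_kaplansky TYPE('a) n \<longleftrightarrow>
    (\<forall>m\<ge>1. \<forall>f :: 'a free_algebra. multilinear m f \<longrightarrow>
       (\<not> S1 n m f \<and> S2 n m f \<longrightarrow> poly_image n m f = sl n) \<and>
       (\<not> S1 n m f \<and> \<not> S2 n m f \<longrightarrow> poly_image n m f = carrier_mat n n))"
    (is "_ \<longleftrightarrow> ?R")
proof
  assume LK: "lvov_kaplansky TYPE('a) n"
  show ?R
  proof (intro allI impI)
    fix m and f :: "'a free_algebra"
    assume m: "m \<ge> 1" and f: "multilinear m f"
    have "poly_image n m f = sl n \<or> poly_image n m f = carrier_mat n n" if "\<not> S1 n m f"
    proof -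
      have "\<not> poly_image n m f \<subseteq> scalar_matrices n"
        by (rule not_S1_imp_nonscalar[OF f that])
      then have "poly_image n m f \<noteq> {0\<^sub>m n n}" "poly_image n m f \<noteq> scalar_matrices n"
        using zero_in_scalar_matrices[of n] by auto
      moreover have "poly_image n m f = {0\<^sub>m n n} \<or> poly_image n m f = scalar_matrices n \<or>
          poly_image n m f = sl n \<or> poly_image n m f = carrier_mat n n"
        using LK m f unfolding lvov_kaplansky_def by simp
      ultimately show ?thesis by simp
    qed
    then show "(\<not> S1 n m f \<and> S2 n m f \<longrightarrow> poly_image n m f = sl n) \<and>
       (\<not> S1 n m f \<and> \<not> S2 n m f \<longrightarrow> poly_image n m f = carrier_mat n n)"
      using S2_iff_image_subset_sl[OF f, of n] carrier_mat_not_subset_sl[OF assms(1), where 'a = 'a]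
      by auto
  qed
next
  assume R: ?R
  show "lvov_kaplansky TYPE('a) n"
    unfolding lvov_kaplansky_def
  proof (intro allI impI)
    fix m and f :: "'a free_algebra"
    assume m: "m \<ge> 1" and f: "multilinear m f"
    show "poly_image n m f = {0\<^sub>m n n} \<or> poly_image n m f = scalar_matrices n \<or>
        poly_image n m f = sl n \<or> poly_image n m f = carrier_mat n n"
    proof (cases "S1 n m f")
      case True
      then show ?thesis
        using S1_imp_image[OF f m True] by blast
    next
      case False
      then show ?thesis
        using R m f by (cases "S2 n m f") simp_all
    qed
  qed
qed

end
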